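(* Let $\gamma=\frac{\sqrt5+1}{2}$ and $i=\sqrt{-1}$. For $n\ge3$, the number of spanning trees of $G^{H_3}_{0,n-1}$ is $$\begin{aligned} &\frac{\gamma^2-\gamma^{3/2}}{4\sqrt5}\big(\gamma+\sqrt\gamma\big)^n-\frac12+\frac{\gamma^2+\gamma^{3/2}}{4\sqrt5}\big(\gamma-\sqrt\gamma\big)^n\\ &\quad+\frac{-\gamma^{-2}-i\gamma^{-3/2}}{4\sqrt5}\big(-\gamma^{-1}+i/\sqrt\gamma\big)^n+\frac{-\gamma^{-2}+i\gamma^{-3/2}}{4\sqrt5}\big(-\gamma^{-1}-i/\sqrt\gamma\big)^n. \end{aligned}$$
   Context: The helix-3-graph $G^{H_3}$ has vertex set $\mathbb{Z}$ and edges $z_m=\{m-1,m\}$ and $h_m=\{m-3,m\}$ for $m\in\mathbb{Z}$. $G^{H_3}_{0,n-1}$ is the subgraph induced by $\{0,\dots,n-1\}$. *)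

theory Defs
  imports Complex_Main
begin

text \<open>
  Undirected graphs without loops or multiple edges, possibly infinite; an edge is the
  two-element set of its ends. (The notions \<open>forest\<close> and \<open>spanning_tree\<close> of the AFP entry
  Graph_Theory refer to directed cycles, so they do not give the undirected notions.)
\<close>

record 'v ugraph =
  uverts :: "'v set"
  uedges :: "'v set set"

definition simple_ugraph :: "'v ugraph \<Rightarrow> bool" where
  "simple_ugraph G \<longleftrightarrow>
     (\<forall>e \<in> uedges G. \<exists>u v. u \<in> uverts G \<and> v \<in> uverts G \<and> u \<noteq> v \<and> e = {u, v})"

definition usubgraph :: "'v ugraph \<Rightarrow> 'v ugraph \<Rightarrow> bool" where
  "usubgraph H G \<longleftrightarrow> simple_ugraph H \<and> uverts H \<subseteq> uverts G \<and> uedges H \<subseteq> uedges G"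

definition uinduced :: "'v ugraph \<Rightarrow> 'v set \<Rightarrow> 'v ugraph" where
  "uinduced G S = \<lparr>uverts = uverts G \<inter> S, uedges = {e \<in> uedges G. e \<subseteq> S}\<rparr>"

definition uconnected :: "'v ugraph \<Rightarrow> bool" where
  "uconnected G \<longleftrightarrow> uverts G \<noteq> {} \<and>
     (\<forall>u \<in> uverts G. \<forall>v \<in> uverts G. (u, v) \<in> {(x, y). {x, y} \<in> uedges G}\<^sup>*)"

text \<open>A cycle is given by the list of its distinct vertices in cyclic order.\<close>

definition ucycle :: "'v ugraph \<Rightarrow> 'v list \<Rightarrow> bool" where
  "ucycle G vs \<longleftrightarrow> 3 \<le> length vs \<and> distinct vs \<and> set vs \<subseteq> uverts G \<and>
     (\<forall>i < length vs. {vs ! i, vs ! ((i + 1) mod length vs)} \<in> uedges G)"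

definition uacyclic :: "'v ugraph \<Rightarrow> bool" where
  "uacyclic G \<longleftrightarrow> (\<nexists>vs. ucycle G vs)"

definition utree :: "'v ugraph \<Rightarrow> bool" where
  "utree G \<longleftrightarrow> uconnected G \<and> uacyclic G"

definition uspanning_tree :: "'v ugraph \<Rightarrow> 'v ugraph \<Rightarrow> bool" where
  "uspanning_tree T G \<longleftrightarrow> usubgraph T G \<and> uverts T = uverts G \<and> utree T"

definition num_spanning_trees :: "'v ugraph \<Rightarrow> nat" where
  "num_spanning_trees G = card {T. uspanning_tree T G}"

definition z_edge :: "int \<Rightarrow> int set" where
  "z_edge m = {m - 1, m}"

definition h_edge :: "int \<Rightarrow> int set" where
  "h_edge m = {m - 3, m}"

definition helix3 :: "int ugraph" where
  "helix3 = \<lparr>uverts = UNIV, uedges = range z_edge \<union> range h_edge\<rparr>"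

definition helix3_segment :: "int \<Rightarrow> int \<Rightarrow> int ugraph" where
  "helix3_segment a b = uinduced helix3 {a..b}"

lemma simple_ugraph_helix3: "simple_ugraph helix3"
  unfolding simple_ugraph_def
proof
  fix e assume "e \<in> uedges helix3"
  then obtain m k :: int where "k \<in> {1, 3}" "e = {m - k, m}"
    by (auto simp: helix3_def z_edge_def h_edge_def)
  then have "m - k \<in> uverts helix3 \<and> m \<in> uverts helix3 \<and> m - k \<noteq> m \<and> e = {m - k, m}"
    by (auto simp: helix3_def)
  then show "\<exists>u v. u \<in> uverts helix3 \<and> v \<in> uverts helix3 \<and> u \<noteq> v \<and> e = {u, v}"
    by (intro exI)
qed

lemma simple_ugraph_uinduced:
  assumes "simple_ugraph G"
  shows "simple_ugraph (uinduced G S)"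
  unfolding simple_ugraph_def
proof
  fix e assume "e \<in> uedges (uinduced G S)"
  then have e: "e \<in> uedges G" "e \<subseteq> S" by (simp_all add: uinduced_def)
  from assms e(1) obtain u v where uv: "u \<in> uverts G" "v \<in> uverts G" "u \<noteq> v" "e = {u, v}"
    unfolding simple_ugraph_def by blast
  with e(2) have "u \<in> uverts (uinduced G S) \<and> v \<in> uverts (uinduced G S) \<and> u \<noteq> v \<and> e = {u, v}"
    by (simp add: uinduced_def)
  then show "\<exists>u v. u \<in> uverts (uinduced G S) \<and> v \<in> uverts (uinduced G S) \<and> u \<noteq> v \<and> e = {u, v}"
    by (intro exI)
qed

end

theory Submission
  imports Defs "HOL-Library.Transitive_Closure_Table"
begin

text \<open>
  The proof is a transfer matrix argument. Let the helix grow one vertex at a time. When the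
  vertex \<open>w\<close> arrives behind the last three vertices \<open>a\<close>, \<open>b\<close>, \<open>c\<close>, it brings exactly the two
  edges \<open>{a, w}\<close> and \<open>{c, w}\<close>, and every later vertex can only be joined to \<open>b\<close>, \<open>c\<close>, \<open>w\<close> or to
  vertices that come later still. Hence an edge set on the part built so far can be completed to
  a spanning tree only if it is a forest in which every vertex hangs together with one of the
  last three, and all that matters for the completion is which of these three lie in the same
  component. There are five such patterns, and the lemma \<open>rooted_attach\<close> shows that the pattern
  after the new vertex is a function of the pattern before it and of the choice of new edges.
  Counting forests by pattern gives the linear system \<open>transfer_matrix\<close>; the spanning trees
  are the counted forests whose last three vertices lie in one component.

  The system has an eigenvalue \<open>1\<close>, visible as the invariant \<open>transfer_invariant\<close>. Using it to
  eliminate the other patterns leaves for the number \<open>t\<close> of spanning trees the recurrence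
  \<open>t (k + 4) = 2 * t (k + 3) + 2 * t (k + 2) + 2 * t (k + 1) - t k + 2\<close>. The constant
  solution is \<open>- 1 / 2\<close>, and the characteristic polynomial of the homogeneous part factors as
  \<open>x^4 - 2 * x^3 - 2 * x^2 - 2 * x + 1 = (x^2 - 2 * \<gamma> * x + 1) * (x^2 + 2 * x / \<gamma> + 1)\<close>;
  its roots are the four bases in the formula. So it suffices to compare initial values.
\<close>

section \<open>Reachability and forests\<close>

definition reach :: "'v set set \<Rightarrow> ('v \<times> 'v) set" where
  "reach E = {(x, y). {x, y} \<in> E}\<^sup>*"

text \<open>
  Acyclicity is expressed by saying that every edge is a bridge. Unlike the absence of a cyclic
  list of vertices, this form behaves well when edges are added one by one.
\<close>

definition forest :: "'v set set \<Rightarrow> bool" where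
  "forest E \<longleftrightarrow> (\<forall>x y. {x, y} \<in> E \<longrightarrow> (x, y) \<notin> reach (E - {{x, y}}))"

lemma reach_refl [simp]: "(x, x) \<in> reach E"
  by (simp add: reach_def)

lemma reach_empty: "(x, y) \<in> reach {} \<longleftrightarrow> x = y"
  by (simp add: reach_def)

lemma reach_edge: "{x, y} \<in> E \<Longrightarrow> (x, y) \<in> reach E"
  by (auto simp: reach_def)

lemma reach_trans: "(x, y) \<in> reach E \<Longrightarrow> (y, z) \<in> reach E \<Longrightarrow> (x, z) \<in> reach E"
  unfolding reach_def by (rule rtrancl_trans)

lemma reach_sym: "(x, y) \<in> reach E \<Longrightarrow> (y, x) \<in> reach E"
proof -
  have "sym {(x, y). {x, y} \<in> E}"
    by (auto simp: sym_def insert_commute)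
  then show "(x, y) \<in> reach E \<Longrightarrow> (y, x) \<in> reach E"
    unfolding reach_def by (meson sym_rtrancl symD)
qed

lemma reach_mono: "E \<subseteq> E' \<Longrightarrow> (x, y) \<in> reach E \<Longrightarrow> (x, y) \<in> reach E'"
  unfolding reach_def by (erule rev_subsetD) (auto intro!: rtrancl_mono)

text \<open>A walk that crosses a new edge can be shortened until it crosses that edge only once.\<close>

lemma reach_insert:
  "(x, y) \<in> reach (insert {u, v} E) \<longleftrightarrow>
     (x, y) \<in> reach E \<or> (x, u) \<in> reach E \<and> (v, y) \<in> reach E
       \<or> (x, v) \<in> reach E \<and> (u, y) \<in> reach E"
proof
  assume "(x, y) \<in> reach (insert {u, v} E)"
  then show "(x, y) \<in> reach E \<or> (x, u) \<in> reach E \<and> (v, y) \<in> reach E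
       \<or> (x, v) \<in> reach E \<and> (u, y) \<in> reach E"
    unfolding reach_def[of "insert {u, v} E"]
  proof (induction rule: rtrancl_induct)
    case base
    show ?case by simp
  next
    case (step y z)
    then consider "(y, z) \<in> reach E" | "y = u" "z = v" | "y = v" "z = u"
      by (auto simp: doubleton_eq_iff dest: reach_edge)
    then show ?case
      by cases (use step.IH in \<open>auto intro: reach_trans\<close>)
  qed
next
  have sub: "\<And>p q. (p, q) \<in> reach E \<Longrightarrow> (p, q) \<in> reach (insert {u, v} E)"
    by (rule reach_mono) auto
  have "(u, v) \<in> reach (insert {u, v} E)" by (simp add: reach_edge)
  then show "(x, y) \<in> reach (insert {u, v} E)"
    if "(x, y) \<in> reach E \<or> (x, u) \<in> reach E \<and> (v, y) \<in> reach E
       \<or> (x, v) \<in> reach E \<and> (u, y) \<in> reach E"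
    using that by (meson sub reach_trans reach_sym)
qed

lemma reach_isolated:
  assumes "\<And>e. e \<in> E \<Longrightarrow> w \<notin> e"
  shows "(x, w) \<in> reach E \<longleftrightarrow> x = w" and "(w, x) \<in> reach E \<longleftrightarrow> x = w"
proof -
  have "(x, w) \<in> reach E \<Longrightarrow> x = w" for x
    unfolding reach_def by (erule rtranclE) (use assms in auto)
  then show "(x, w) \<in> reach E \<longleftrightarrow> x = w" and "(w, x) \<in> reach E \<longleftrightarrow> x = w"
    using reach_sym by fastforce+
qed

lemma forest_empty: "forest {}"
  by (simp add: forest_def)

text \<open>
  A new edge closes a cycle precisely when its ends were connected before. Conversely, if some old
  edge \<open>{x, y}\<close> stops being a bridge, then the detour from \<open>x\<close> to \<open>y\<close> runs through \<open>{u, v}\<close>,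
  and going round the other way, through \<open>{x, y}\<close>, connects \<open>u\<close> and \<open>v\<close> without the new edge.
\<close>

lemma forest_insert:
  assumes "{u, v} \<notin> E"
  shows "forest (insert {u, v} E) \<longleftrightarrow> forest E \<and> (u, v) \<notin> reach E"
proof (intro iffI conjI)
  assume F: "forest (insert {u, v} E)"
  show "forest E"
    unfolding forest_def
  proof (intro allI impI)
    fix x y assume "{x, y} \<in> E"
    then have "(x, y) \<notin> reach (insert {u, v} E - {{x, y}})"
      using F by (simp add: forest_def)
    then show "(x, y) \<notin> reach (E - {{x, y}})"
      using reach_mono[of "E - {{x, y}}" "insert {u, v} E - {{x, y}}"] by blast
  qed
  show "(u, v) \<notin> reach E"
    using F assms unfolding forest_def by (metis Diff_insert_absorb insertI1)
next
  assume F: "forest E \<and> (u, v) \<notin> reach E"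
  show "forest (insert {u, v} E)"
    unfolding forest_def
  proof (intro allI impI notI)
    fix x y
    assume xy: "{x, y} \<in> insert {u, v} E" "(x, y) \<in> reach (insert {u, v} E - {{x, y}})"
    show False
    proof (cases "{x, y} = {u, v}")
      case True
      then have "(x, y) \<in> reach E"
        using xy(2) assms by (simp add: insert_Diff_if)
      then show False
        using True F by (auto simp: doubleton_eq_iff dest: reach_sym)
    next
      case False
      let ?E = "E - {{x, y}}"
      have E: "{x, y} \<in> E" using xy(1) False by simp
      have *: "(x, y) \<in> reach (insert {u, v} ?E)"
        using xy(2) False by (simp add: insert_Diff_if)
      have up: "(p, q) \<in> reach ?E \<Longrightarrow> (p, q) \<in> reach E" for p q
        by (rule reach_mono[of ?E]) auto
      have "(x, y) \<notin> reach ?E" using F E by (simp add: forest_def)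
      with * have "(x, u) \<in> reach E \<and> (v, y) \<in> reach E \<or> (x, v) \<in> reach E \<and> (u, y) \<in> reach E"
        unfolding reach_insert using up by blast
      then have "(u, v) \<in> reach E"
        using reach_edge[OF E] by (meson reach_trans reach_sym)
      then show False using F by simp
    qed
  qed
qed

text \<open>
  If an edge is not a bridge, a path that joins its ends and avoids the edge is closed by it to a
  cycle; in the other direction, the closing edge of a cycle is bypassed by the rest of the cycle.
\<close>

lemma uacyclic_iff_forest:
  assumes "simple_ugraph G"
  shows "uacyclic G \<longleftrightarrow> forest (uedges G)"
proof
  assume ac: "uacyclic G"
  show "forest (uedges G)"
    unfolding forest_def
  proof (intro allI impI notI)
    fix x y
    assume e: "{x, y} \<in> uedges G" and r: "(x, y) \<in> reach (uedges G - {{x, y}})"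
    let ?R = "\<lambda>p q. {p, q} \<in> uedges G - {{x, y}}"
    have xy: "x \<noteq> y" "x \<in> uverts G"
      using assms e unfolding simple_ugraph_def by (auto simp: doubleton_eq_iff dest!: bspec)
    have "?R\<^sup>*\<^sup>* x y"
      using r by (simp add: reach_def rtranclp_rtrancl_eq)
    then obtain ps where "rtrancl_path ?R x ps y"
      by (auto simp: rtranclp_eq_rtrancl_path)
    then obtain ps where p: "rtrancl_path ?R x ps y" and d: "distinct (x # ps)"
      using rtrancl_path_distinct by metis
    have ne: "ps \<noteq> []" using p xy(1) by (auto elim: rtrancl_path.cases)
    have l: "last ps = y" using rtrancl_path_last[OF p ne] .
    have st: "{(x # ps) ! i, ps ! i} \<in> uedges G - {{x, y}}" if "i < length ps" for i
      using rtrancl_path_nth[OF p that] .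
    \<comment> \<open>A path of one step would be the edge \<open>{x, y}\<close> itself, which has been removed.\<close>
    have len: "length ps \<ge> 2"
    proof (rule ccontr)
      assume "\<not> length ps \<ge> 2"
      with ne have "length ps = 1" by (cases ps) (auto simp: not_less_eq_eq)
      then have "ps = [y]" using l by (cases ps) auto
      then show False using st[of 0] by simp
    qed
    have inV: "ps ! i \<in> uverts G" if "i < length ps" for i
      using st[OF that] assms unfolding simple_ugraph_def
      by (metis DiffD1 doubleton_eq_iff)
    have "ucycle G (x # ps)"
      unfolding ucycle_def
    proof (intro conjI allI impI)
      show "3 \<le> length (x # ps)" using len by simp
      show "distinct (x # ps)" by (rule d)
      show "set (x # ps) \<subseteq> uverts G" using inV xy(2) by (auto simp: in_set_conv_nth)
      fix i assume i: "i < length (x # ps)"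
      show "{(x # ps) ! i, (x # ps) ! ((i + 1) mod length (x # ps))} \<in> uedges G"
      proof (cases "i < length ps")
        case True
        then show ?thesis using st[of i] by simp
      next
        case False
        with i have "i = length ps" by simp
        then have "(x # ps) ! i = y" "(x # ps) ! ((i + 1) mod length (x # ps)) = x"
          using l ne by (simp_all add: last_conv_nth)
        then show ?thesis using e by (simp add: insert_commute)
      qed
    qed
    then show False using ac by (auto simp: uacyclic_def)
  qed
next
  assume F: "forest (uedges G)"
  show "uacyclic G"
    unfolding uacyclic_def
  proof
    assume "\<exists>vs. ucycle G vs"
    then obtain vs where len: "3 \<le> length vs" and d: "distinct vs"
      and E: "\<And>i. i < length vs \<Longrightarrow> {vs ! i, vs ! ((i + 1) mod length vs)} \<in> uedges G"
      unfolding ucycle_def by blast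
    define k where "k = length vs - 1"
    have k: "k < length vs" "Suc k = length vs" "k \<ge> 2" using len by (auto simp: k_def)
    have ix: "vs ! p = vs ! q \<longleftrightarrow> p = q" if "p \<le> k" "q \<le> k" for p q
      using nth_eq_iff_index_eq[OF d] that k by simp
    let ?E = "uedges G - {{vs ! 0, vs ! k}}"
    have "(vs ! 0, vs ! i) \<in> reach ?E" if "i \<le> k" for i
      using that
    proof (induction i)
      case 0
      show ?case by simp
    next
      case (Suc i)
      have "{vs ! i, vs ! Suc i} \<in> uedges G" using E[of i] Suc.prems k by simp
      moreover have "{vs ! i, vs ! Suc i} \<noteq> {vs ! 0, vs ! k}"
        using Suc.prems k(3) by (auto simp: doubleton_eq_iff ix)
      ultimately have "(vs ! i, vs ! Suc i) \<in> reach ?E" by (simp add: reach_edge)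
      then show ?case using Suc reach_trans by fastforce
    qed
    moreover have "{vs ! 0, vs ! k} \<in> uedges G"
      using E[of k] k by (simp add: insert_commute)
    ultimately show False using F by (auto simp: forest_def)
  qed
qed

section \<open>Attaching a vertex to a rooted forest\<close>

text \<open>
  The five partitions of an ordered triple of boundary vertices (left, middle, right) into components: all
  separate, exactly one pair joined, or all three joined.
\<close>

datatype pattern = Sep | LM | LR | MR | LMR

definition pattern_of :: "'v \<Rightarrow> 'v \<Rightarrow> 'v \<Rightarrow> 'v set set \<Rightarrow> pattern" where
  "pattern_of a b c F =
     (if (a, b) \<in> reach F then if (b, c) \<in> reach F then LMR else LM
      else if (a, c) \<in> reach F then LR
      else if (b, c) \<in> reach F then MR else Sep)"

text \<open>
  The forests that can still grow into a spanning tree when only \<open>a\<close>, \<open>b\<close>, \<open>c\<close> and new vertices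
  receive further edges: a component without a boundary vertex would stay separate forever.
\<close>

definition rooted :: "'v set \<Rightarrow> 'v \<Rightarrow> 'v \<Rightarrow> 'v \<Rightarrow> 'v set set \<Rightarrow> bool" where
  "rooted V a b c F \<longleftrightarrow> forest F \<and>
     (\<forall>v \<in> V. (v, a) \<in> reach F \<or> (v, b) \<in> reach F \<or> (v, c) \<in> reach F)"

definition attach :: "'v \<Rightarrow> 'v \<Rightarrow> 'v \<Rightarrow> bool \<Rightarrow> bool \<Rightarrow> 'v set set" where
  "attach a c w p q = (if p then {{a, w}} else {}) \<union> (if q then {{c, w}} else {})"

text \<open>
  The effect on the pattern when a new vertex \<open>w\<close> is joined to the left vertex (first flag) and
  to the right vertex (second flag), after which the left vertex leaves the boundary. The value
  \<open>None\<close> means either that the left vertex is lost, being joined to none of the vertices that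
  remain, or that two new edges into the same component close a cycle.
\<close>

fun step :: "bool \<Rightarrow> bool \<Rightarrow> pattern \<Rightarrow> pattern option" where
  "step False False P = (case P of LM \<Rightarrow> Some Sep | LR \<Rightarrow> Some Sep | LMR \<Rightarrow> Some LM | _ \<Rightarrow> None)"
| "step False True P = (case P of LM \<Rightarrow> Some MR | LR \<Rightarrow> Some MR | LMR \<Rightarrow> Some LMR | _ \<Rightarrow> None)"
| "step True False P =
     Some (case P of Sep \<Rightarrow> Sep | LM \<Rightarrow> LR | LR \<Rightarrow> MR | MR \<Rightarrow> LM | LMR \<Rightarrow> LMR)"
| "step True True P =
     (case P of Sep \<Rightarrow> Some MR | LM \<Rightarrow> Some LMR | MR \<Rightarrow> Some LMR | _ \<Rightarrow> None)"

text \<open>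
  Since \<open>w\<close> is isolated in \<open>F\<close>, reachability after the attachment is a propositional combination
  of reachability in \<open>F\<close>. A vertex of \<open>V\<close> that was connected to \<open>b\<close> or \<open>c\<close> remains so; one that
  was connected to \<open>a\<close> alone stays rooted exactly when \<open>a\<close> itself does. What remains is a comparison
  with the table of \<open>step\<close> in the cases that transitivity permits.
\<close>

lemma rooted_attach:
  assumes abc: "a \<in> V" "b \<in> V" "c \<in> V" "a \<noteq> c" and w: "w \<notin> V"
    and F: "\<And>e. e \<in> F \<Longrightarrow> e \<subseteq> V"
  shows "rooted (insert w V) b c w (attach a c w p q \<union> F) \<and>
           pattern_of b c w (attach a c w p q \<union> F) = P'
         \<longleftrightarrow> rooted V a b c F \<and> step p q (pattern_of a b c F) = Some P'"
proof -
  have iso: "(x, w) \<in> reach F \<longleftrightarrow> x = w" "(w, x) \<in> reach F \<longleftrightarrow> x = w" for x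
    using reach_isolated[of F w x] F w by blast+
  have new: "{a, w} \<notin> F" "{c, w} \<notin> F" using F w by blast+
  have ne: "w \<noteq> a" "w \<noteq> b" "w \<noteq> c" "a \<noteq> w" "b \<noteq> w" "c \<noteq> w" using abc w by blast+
  have V: "v \<noteq> w" if "v \<in> V" for v using that w by blast
  let ?F' = "attach a c w p q \<union> F"
  have sym: "(x, y) \<in> reach F \<longleftrightarrow> (y, x) \<in> reach F" for x y
    by (rule iffI; rule reach_sym)
  have tr: "(x, z) \<in> reach F" if "(x, y) \<in> reach F" "(y, z) \<in> reach F" for x y z
    using that by (rule reach_trans)
  have new2: "{c, w} \<noteq> {a, w}" using abc ne by (auto simp: doubleton_eq_iff)
  have forest': "forest ?F' \<longleftrightarrow> forest F \<and> \<not> (p \<and> q \<and> (a, c) \<in> reach F)"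
    by (cases p; cases q)
      (simp_all add: attach_def forest_insert new new2 reach_insert iso ne sym[of c a])
  have old: "(x, y) \<in> reach ?F' \<longleftrightarrow> (x, y) \<in> reach F
      \<or> p \<and> q \<and> ((x, a) \<in> reach F \<and> (c, y) \<in> reach F \<or> (x, c) \<in> reach F \<and> (a, y) \<in> reach F)"
    if "x \<in> V" "y \<in> V" for x y
    using V[OF that(1)] V[OF that(2)] ne
    by (cases p; cases q) (simp_all add: attach_def reach_insert iso disj_ac)
  have fresh: "(x, w) \<in> reach ?F' \<longleftrightarrow> p \<and> (x, a) \<in> reach F \<or> q \<and> (x, c) \<in> reach F"
    if "x \<in> V" for x
    using V[OF that] ne by (cases p; cases q) (simp_all add: attach_def reach_insert iso, blast)
  have cover: "(\<forall>v \<in> insert w V. (v, b) \<in> reach ?F' \<or> (v, c) \<in> reach ?F' \<or> (v, w) \<in> reach ?F')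
     \<longleftrightarrow> (\<forall>v \<in> V. (v, a) \<in> reach F \<or> (v, b) \<in> reach F \<or> (v, c) \<in> reach F)
        \<and> ((a, b) \<in> reach F \<or> (a, c) \<in> reach F \<or> p)" (is "?L \<longleftrightarrow> ?R")
  proof
    assume ?L
    then have *: "(v, b) \<in> reach ?F' \<or> (v, c) \<in> reach ?F' \<or> (v, w) \<in> reach ?F'" if "v \<in> V" for v
      using that by blast
    have "(v, a) \<in> reach F \<or> (v, b) \<in> reach F \<or> (v, c) \<in> reach F" if "v \<in> V" for v
      using *[OF that] old[OF that abc(2)] old[OF that abc(3)] fresh[OF that] by blast
    moreover have "(a, b) \<in> reach F \<or> (a, c) \<in> reach F \<or> p"
      using *[OF abc(1)] old[OF abc(1,2)] old[OF abc(1,3)] fresh[OF abc(1)] by blast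
    ultimately show ?R by blast
  next
    assume R: ?R
    have "(v, b) \<in> reach ?F' \<or> (v, c) \<in> reach ?F' \<or> (v, w) \<in> reach ?F'" if "v \<in> V" for v
      using R that old[OF that abc(2)] old[OF that abc(3)] fresh[OF that] tr by blast
    then show ?L by simp
  qed
  \<comment> \<open>Naming the three relevant truth values turns the claim into a propositional statement.\<close>
  define ab bc ac where "ab \<longleftrightarrow> (a, b) \<in> reach F" and "bc \<longleftrightarrow> (b, c) \<in> reach F"
    and "ac \<longleftrightarrow> (a, c) \<in> reach F"
  note joined = ab_def[symmetric] bc_def[symmetric] ac_def[symmetric]
    sym[of b a, folded ab_def] sym[of c b, folded bc_def] sym[of c a, folded ac_def]
  have "ab \<and> bc \<longrightarrow> ac" "ab \<and> ac \<longrightarrow> bc" "ac \<and> bc \<longrightarrow> ab"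
    unfolding ab_def bc_def ac_def using tr sym by metis+
  then show ?thesis
    unfolding rooted_def forest' cover pattern_of_def old[OF abc(2,3)] fresh[OF abc(2)]
      fresh[OF abc(3)] joined
    by (cases p; cases q; cases ab; cases bc; cases ac) simp_all
qed

section \<open>The transfer matrix of the helix\<close>

text \<open>
  The index is shifted by three: \<open>k\<close> stands for the segment with the \<open>k + 3\<close> vertices
  \<open>0, \<dots>, k + 2\<close>, whose boundary consists of \<open>k\<close>, \<open>k + 1\<close>, \<open>k + 2\<close>.
\<close>

definition segment_edges :: "nat \<Rightarrow> int set set" where
  "segment_edges k = uedges (helix3_segment 0 (int k + 2))"

definition states :: "nat \<Rightarrow> pattern \<Rightarrow> int set set set" where
  "states k P = {F. F \<subseteq> segment_edges k
     \<and> rooted {0..int k + 2} (int k) (int k + 1) (int k + 2) F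
     \<and> pattern_of (int k) (int k + 1) (int k + 2) F = P}"

lemma mem_segment_edges:
  "e \<in> segment_edges k \<longleftrightarrow>
     (\<exists>m. 1 \<le> m \<and> m \<le> int k + 2 \<and> e = {m - 1, m}) \<or> (\<exists>m. 3 \<le> m \<and> m \<le> int k + 2 \<and> e = {m - 3, m})"
proof -
  have "{m - 1, m} \<subseteq> {0..int k + 2} \<longleftrightarrow> 1 \<le> m \<and> m \<le> int k + 2"
    and "{m - 3, m} \<subseteq> {0..int k + 2} \<longleftrightarrow> 3 \<le> m \<and> m \<le> int k + 2" for m
    by auto
  moreover have "e \<in> segment_edges k \<longleftrightarrow>
      ((\<exists>m. e = {m - 1, m}) \<or> (\<exists>m. e = {m - 3, m})) \<and> e \<subseteq> {0..int k + 2}"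
    by (auto simp: segment_edges_def helix3_segment_def uinduced_def helix3_def
        z_edge_def h_edge_def image_iff)
  ultimately show ?thesis by metis
qed

lemma segment_edges_subset: "e \<in> segment_edges k \<Longrightarrow> e \<subseteq> {0..int k + 2}"
  by (auto simp: mem_segment_edges)

lemma segment_edges_0: "segment_edges 0 = {{0, 1}, {1, 2}}"
proof -
  have one: "1 \<le> m \<and> m \<le> 2 \<and> R \<longleftrightarrow> (m = 1 \<or> m = 2) \<and> R"
    and three: "\<not> (3 \<le> m \<and> m \<le> 2 \<and> R)" for m :: int and R by auto
  show ?thesis
    by (simp add: set_eq_iff mem_segment_edges one three conj_disj_distribR ex_disj_distrib
        del: insert_iff) auto
qed

lemma segment_edges_Suc:
  "segment_edges (Suc k) = {{int k, int k + 3}, {int k + 2, int k + 3}} \<union> segment_edges k"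
proof -
  have top: "(\<exists>m. l \<le> m \<and> m \<le> int (Suc k) + 2 \<and> e = f m)
      \<longleftrightarrow> e = f (int k + 3) \<or> (\<exists>m. l \<le> m \<and> m \<le> int k + 2 \<and> e = f m)"
    if "l \<le> int k + 3" for l :: int and f :: "int \<Rightarrow> int set" and e
  proof -
    have "m \<le> int (Suc k) + 2 \<longleftrightarrow> m = int k + 3 \<or> m \<le> int k + 2" for m by auto
    then show ?thesis using that by metis
  qed
  have z: "(\<exists>m. 1 \<le> m \<and> m \<le> int (Suc k) + 2 \<and> e = {m - 1, m})
      \<longleftrightarrow> e = {int k + 2, int k + 3} \<or> (\<exists>m. 1 \<le> m \<and> m \<le> int k + 2 \<and> e = {m - 1, m})"
    and h: "(\<exists>m. 3 \<le> m \<and> m \<le> int (Suc k) + 2 \<and> e = {m - 3, m})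
      \<longleftrightarrow> e = {int k, int k + 3} \<or> (\<exists>m. 3 \<le> m \<and> m \<le> int k + 2 \<and> e = {m - 3, m})" for e
    using top[of 1 e "\<lambda>m. {m - 1, m}"] top[of 3 e "\<lambda>m. {m - 3, m}"]
    by (simp_all add: add.commute)
  have "e \<in> segment_edges (Suc k)
      \<longleftrightarrow> e = {int k, int k + 3} \<or> e = {int k + 2, int k + 3} \<or> e \<in> segment_edges k" for e
    unfolding mem_segment_edges z h by blast
  then show ?thesis by blast
qed

lemma finite_segment_edges: "finite (segment_edges k)"
  by (induction k) (simp_all add: segment_edges_0 segment_edges_Suc)

lemma finite_states: "finite (states k P)"
  by (rule finite_subset[of _ "Pow (segment_edges k)"]) (auto simp: states_def finite_segment_edges)

lemma UNIV_pattern: "UNIV = {Sep, LM, LR, MR, LMR}"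
  by (auto intro: pattern.exhaust)

text \<open>
  An edge set on the longer segment splits uniquely into its edges at the new vertex \<open>k + 3\<close> and
  its restriction to the old segment.
\<close>

lemma states_Suc:
  "states (Suc k) P' = (\<lambda>(p, q, F). attach (int k) (int k + 2) (int k + 3) p q \<union> F) `
     (SIGMA p:UNIV. SIGMA q:UNIV. \<Union>P\<in>{P. step p q P = Some P'}. states k P)"
  (is "_ = ?f ` ?D")
proof -
  let ?w = "int k + 3"
  have ext: "rooted {0..int (Suc k) + 2} (int (Suc k)) (int (Suc k) + 1) (int (Suc k) + 2)
        (attach (int k) (int k + 2) ?w p q \<union> F) \<and>
      pattern_of (int (Suc k)) (int (Suc k) + 1) (int (Suc k) + 2)
        (attach (int k) (int k + 2) ?w p q \<union> F) = P'
    \<longleftrightarrow> rooted {0..int k + 2} (int k) (int k + 1) (int k + 2) F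
      \<and> step p q (pattern_of (int k) (int k + 1) (int k + 2) F) = Some P'"
    if "F \<subseteq> segment_edges k" for p q F
  proof -
    have V: "{0..int (Suc k) + 2} = insert ?w {0..int k + 2}"
      and b: "int (Suc k) = int k + 1" "int k + 1 + 1 = int k + 2" "int k + 1 + 2 = ?w"
      by auto
    show ?thesis
      unfolding V unfolding b
      by (rule rooted_attach) (use that segment_edges_subset in auto)
  qed
  show ?thesis
  proof (intro equalityI subsetI)
    fix G assume G: "G \<in> states (Suc k) P'"
    define p where "p \<longleftrightarrow> {int k, ?w} \<in> G"
    define q where "q \<longleftrightarrow> {int k + 2, ?w} \<in> G"
    define F where "F = G \<inter> segment_edges k"
    have "G \<subseteq> segment_edges (Suc k)" using G by (simp add: states_def)
    then have eq: "G = attach (int k) (int k + 2) ?w p q \<union> F"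
      unfolding segment_edges_Suc by (auto simp: attach_def p_def q_def F_def)
    have F: "F \<subseteq> segment_edges k" by (simp add: F_def)
    have "F \<in> states k (pattern_of (int k) (int k + 1) (int k + 2) F)"
      and "step p q (pattern_of (int k) (int k + 1) (int k + 2) F) = Some P'"
      using G ext[OF F, of p q] F unfolding states_def eq[symmetric] by auto
    then have "(p, q, F) \<in> ?D" by blast
    then have "?f (p, q, F) \<in> ?f ` ?D" by (rule imageI)
    then show "G \<in> ?f ` ?D" unfolding eq by simp
  next
    fix G assume "G \<in> ?f ` ?D"
    then obtain p q F where eq: "G = attach (int k) (int k + 2) ?w p q \<union> F"
      and F: "F \<in> states k (pattern_of (int k) (int k + 1) (int k + 2) F)"
        "step p q (pattern_of (int k) (int k + 1) (int k + 2) F) = Some P'"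
      by (auto simp: states_def)
    have sub: "F \<subseteq> segment_edges k" using F by (simp add: states_def)
    then have "G \<subseteq> segment_edges (Suc k)"
      unfolding eq segment_edges_Suc by (auto simp: attach_def split: if_splits)
    then show "G \<in> states (Suc k) P'"
      using ext[OF sub, of p q] F unfolding states_def eq by simp
  qed
qed

lemma attach_inject:
  fixes k :: nat
  defines "w \<equiv> int k + 3"
  assumes F: "F \<subseteq> segment_edges k" "F' \<subseteq> segment_edges k"
    and eq: "attach (int k) (int k + 2) w p q \<union> F = attach (int k) (int k + 2) w p' q' \<union> F'"
      (is "?G = ?G'")
  shows "p = p' \<and> q = q' \<and> F = F'"
proof -
  have new: "{int k, w} \<notin> segment_edges k" "{int k + 2, w} \<notin> segment_edges k"
    using segment_edges_subset unfolding w_def by force+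
  have ne: "{int k, w} \<noteq> {int k + 2, w}" by (auto simp: doubleton_eq_iff)
  have "p \<longleftrightarrow> {int k, w} \<in> ?G" "p' \<longleftrightarrow> {int k, w} \<in> ?G'"
    using new F ne by (auto simp: attach_def)
  moreover have "q \<longleftrightarrow> {int k + 2, w} \<in> ?G" "q' \<longleftrightarrow> {int k + 2, w} \<in> ?G'"
    using new F ne by (auto simp: attach_def)
  moreover have "F = ?G \<inter> segment_edges k" "F' = ?G' \<inter> segment_edges k"
    using new F by (auto simp: attach_def)
  ultimately show ?thesis using eq by metis
qed

lemma card_states_Suc:
  "card (states (Suc k) P') =
     (\<Sum>p\<in>UNIV. \<Sum>q\<in>UNIV. \<Sum>P\<in>UNIV. if step p q P = Some P' then card (states k P) else 0)"
proof -
  let ?D = "SIGMA p:UNIV. SIGMA q:UNIV. \<Union>P\<in>{P. step p q P = Some P'}. states k P"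
  have finP: "finite A" for A :: "pattern set"
    by (rule finite_subset[OF subset_UNIV]) (simp add: UNIV_pattern)
  have filter_sum: "(\<Sum>P\<in>{P. Q P}. g P) = (\<Sum>P\<in>UNIV. if Q P then g P else 0)"
    for Q and g :: "pattern \<Rightarrow> nat"
    using sum.inter_filter[OF finP[of UNIV], of g Q] by simp
  have sub: "F \<subseteq> segment_edges k" if "(p, q, F) \<in> ?D" for p q F
    using that by (auto simp: states_def)
  have "inj_on (\<lambda>(p, q, F). attach (int k) (int k + 2) (int k + 3) p q \<union> F) ?D"
  proof (rule inj_onI)
    fix x y
    assume D: "x \<in> ?D" "y \<in> ?D"
      and eq: "(\<lambda>(p, q, F). attach (int k) (int k + 2) (int k + 3) p q \<union> F) x
        = (\<lambda>(p, q, F). attach (int k) (int k + 2) (int k + 3) p q \<union> F) y"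
    obtain p q F p' q' F' where xy: "x = (p, q, F)" "y = (p', q', F')"
      by (cases x; cases y)
    have "p = p' \<and> q = q' \<and> F = F'"
      using attach_inject[OF sub sub, OF D[unfolded xy]] eq unfolding xy by simp
    then show "x = y" by (simp add: xy)
  qed
  then have "card (states (Suc k) P') = card ?D"
    unfolding states_Suc by (rule card_image)
  also have "\<dots> = (\<Sum>p\<in>UNIV. \<Sum>q\<in>UNIV. card (\<Union>P\<in>{P. step p q P = Some P'}. states k P))"
    by (simp add: card_SigmaI finP finite_states)
  also have "\<dots> = (\<Sum>p\<in>UNIV. \<Sum>q\<in>UNIV. \<Sum>P\<in>{P. step p q P = Some P'}. card (states k P))"
    by (intro sum.cong refl card_UN_disjoint finP ballI impI finite_states) (auto simp: states_def)
  also have "\<dots> = (\<Sum>p\<in>UNIV. \<Sum>q\<in>UNIV. \<Sum>P\<in>UNIV. if step p q P = Some P' then card (states k P) else 0)"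
    by (simp only: filter_sum)
  finally show ?thesis .
qed

lemma transfer_matrix:
  "card (states (Suc k) Sep) = card (states k Sep) + card (states k LM) + card (states k LR)"
  "card (states (Suc k) LM) = card (states k MR) + card (states k LMR)"
  "card (states (Suc k) LR) = card (states k LM)"
  "card (states (Suc k) MR) = card (states k Sep) + card (states k LM) + 2 * card (states k LR)"
  "card (states (Suc k) LMR) = card (states k LM) + card (states k MR) + 2 * card (states k LMR)"
  by (simp_all add: card_states_Suc UNIV_bool UNIV_pattern)

text \<open>
  The segment on \<open>0, 1, 2\<close> is a path with two edges. All its vertices are boundary vertices, so
  all four edge sets count; only the pattern joining \<open>0\<close> with \<open>2\<close> but not with \<open>1\<close> is missing.
\<close>

lemma initial_states:
  "states 0 Sep = {{}}" "states 0 LM = {{{0, 1}}}" "states 0 LR = {}"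
  "states 0 MR = {{{1, 2}}}" "states 0 LMR = {{{0, 1}, {1, 2}}}"
proof -
  have Pow: "F \<subseteq> segment_edges 0 \<longleftrightarrow> F \<in> {{}, {{0, 1}}, {{1, 2}}, {{0, 1}, {1, 2}}}" for F
    unfolding segment_edges_0 Pow_iff[symmetric] by (auto simp: Pow_insert)
  have V: "{0..2} = {0, 1, 2 :: int}" by auto
  have "forest {{0, 1}, {1, 2 :: int}}" "forest {{0, 1 :: int}}" "forest {{1, 2 :: int}}"
    by (simp_all add: forest_insert forest_empty reach_insert reach_empty doubleton_eq_iff)
  then have R: "rooted {0..2} 0 1 2 F" if "F \<subseteq> segment_edges 0" for F
    using that forest_empty unfolding Pow rooted_def by (auto simp: V)
  have P: "pattern_of 0 1 (2 :: int) {} = Sep" "pattern_of 0 1 2 {{0, 1 :: int}} = LM"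
    "pattern_of 0 1 2 {{1, 2 :: int}} = MR" "pattern_of 0 1 2 {{0, 1}, {1, 2 :: int}} = LMR"
    by (simp_all add: pattern_of_def reach_insert reach_empty)
  have S: "states 0 Q = {F \<in> {{}, {{0, 1}}, {{1, 2}}, {{0, 1}, {1, 2}}}. pattern_of 0 1 2 F = Q}" for Q
    using R by (auto simp: states_def Pow[symmetric] simp del: insert_iff)
  show "states 0 Sep = {{}}" "states 0 LM = {{{0, 1}}}" "states 0 LR = {}"
    "states 0 MR = {{{1, 2}}}" "states 0 LMR = {{{0, 1}, {1, 2}}}"
    unfolding S using P by auto
qed

text \<open>
  A spanning tree is determined by its edges, and these form a rooted forest in which the boundary
  lies in one component, which then contains every vertex.
\<close>

lemma num_spanning_trees_segment:
  "num_spanning_trees (helix3_segment 0 (int k + 2)) = card (states k LMR)"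
proof -
  let ?G = "helix3_segment 0 (int k + 2)" and ?V = "{0..int k + 2}"
  let ?a = "int k" and ?b = "int k + 1" and ?c = "int k + 2"
  have verts: "uverts ?G = ?V"
    by (simp add: helix3_segment_def uinduced_def helix3_def)
  have simple: "simple_ugraph ?G"
    unfolding helix3_segment_def by (intro simple_ugraph_uinduced simple_ugraph_helix3)
  have tree: "uspanning_tree \<lparr>uverts = ?V, uedges = F\<rparr> ?G \<longleftrightarrow> F \<in> states k LMR" for F
  proof (cases "F \<subseteq> segment_edges k")
    case False
    then show ?thesis
      by (simp add: uspanning_tree_def usubgraph_def states_def segment_edges_def)
  next
    case True
    let ?T = "\<lparr>uverts = ?V, uedges = F\<rparr>"
    have simpleT: "simple_ugraph ?T"
    proof -
      have "\<forall>e \<in> uedges ?G. \<exists>u v. u \<in> ?V \<and> v \<in> ?V \<and> u \<noteq> v \<and> e = {u, v}"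
        using simple unfolding simple_ugraph_def verts .
      then have "\<forall>e \<in> F. \<exists>u v. u \<in> ?V \<and> v \<in> ?V \<and> u \<noteq> v \<and> e = {u, v}"
        using True unfolding segment_edges_def by (metis (no_types, lifting) subsetD)
      then show ?thesis by (simp add: simple_ugraph_def)
    qed
    have "uconnected ?T \<longleftrightarrow> (\<forall>u \<in> ?V. \<forall>v \<in> ?V. (u, v) \<in> reach F)"
      by (simp add: uconnected_def reach_def)
    also have "\<dots> \<longleftrightarrow> (\<forall>v \<in> ?V. (v, ?a) \<in> reach F \<or> (v, ?b) \<in> reach F \<or> (v, ?c) \<in> reach F)
        \<and> pattern_of ?a ?b ?c F = LMR" (is "?L \<longleftrightarrow> ?R")
    proof
      assume ?L
      then show ?R by (simp add: pattern_of_def)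
    next
      assume R: ?R
      then have ab: "(?a, ?b) \<in> reach F" "(?b, ?c) \<in> reach F"
        by (auto simp: pattern_of_def split: if_splits)
      have "(v, ?b) \<in> reach F" if "v \<in> ?V" for v
        using R that ab by (meson reach_trans reach_sym)
      then show ?L by (meson reach_trans reach_sym)
    qed
    finally show ?thesis
      using True simpleT verts uacyclic_iff_forest[OF simpleT]
      by (auto simp: uspanning_tree_def usubgraph_def utree_def states_def rooted_def
          segment_edges_def)
  qed
  have "{T. uspanning_tree T ?G} = (\<lambda>F. \<lparr>uverts = ?V, uedges = F\<rparr>) ` states k LMR"
  proof (intro equalityI subsetI)
    fix T assume "T \<in> {T. uspanning_tree T ?G}"
    moreover from this have "T = \<lparr>uverts = ?V, uedges = uedges T\<rparr>"
      using verts by (simp add: uspanning_tree_def)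
    ultimately show "T \<in> (\<lambda>F. \<lparr>uverts = ?V, uedges = F\<rparr>) ` states k LMR"
      using tree[of "uedges T"] by (metis imageI mem_Collect_eq)
  qed (use tree in auto)
  then show ?thesis
    unfolding num_spanning_trees_def by (simp add: card_image inj_on_def)
qed

text \<open>
  The coefficients \<open>1, 1, 1, 0, - 1\<close> are a left eigenvector of the transfer matrix for the
  eigenvalue \<open>1\<close>; the constant on the right is its value on the initial counts \<open>1, 1, 0, 1, 1\<close>.
\<close>

lemma transfer_invariant:
  "card (states k Sep) + card (states k LM) + card (states k LR) = card (states k LMR) + 1"
  by (induction k) (simp_all add: initial_states transfer_matrix)

text \<open>
  Expressed by the counts at \<open>k\<close>, the two sides without the summand \<open>2\<close> differ by twice the
  quantity that \<open>transfer_invariant\<close> shows to be constant.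
\<close>

lemma tree_recurrence:
  "card (states (k + 4) LMR) + card (states k LMR)
     = 2 * card (states (k + 3) LMR) + 2 * card (states (k + 2) LMR) + 2 * card (states (k + 1) LMR) + 2"
  using transfer_invariant[of k]
  by (simp add: eval_nat_numeral transfer_matrix)

section \<open>The closed form\<close>

text \<open>
  The formula in terms of \<open>s = sqrt \<gamma>\<close>. Since \<open>\<gamma>\<^sup>2 = \<gamma> + 1\<close>, negative powers of \<open>s\<close> reduce to
  polynomials, for instance \<open>1 / s = s ^ 3 - s\<close>, and \<open>sqrt 5 = 2 * s\<^sup>2 - 1\<close>. So only the
  relation \<open>s ^ 4 = s\<^sup>2 + 1\<close> is needed to calculate with it.
\<close>

definition golden_formula :: "complex \<Rightarrow> nat \<Rightarrow> complex" where
  "golden_formula s n =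
     ((s ^ 4 - s ^ 3) * (s\<^sup>2 + s) ^ n + (s ^ 4 + s ^ 3) * (s\<^sup>2 - s) ^ n
      - (2 - s\<^sup>2) * (1 + \<i> * s) * (1 - s\<^sup>2 + \<i> * (s ^ 3 - s)) ^ n
      - (2 - s\<^sup>2) * (1 - \<i> * s) * (1 - s\<^sup>2 - \<i> * (s ^ 3 - s)) ^ n) / (4 * (2 * s\<^sup>2 - 1)) - 1 / 2"

lemma power_recurrence:
  fixes r :: "'a :: comm_ring_1"
  assumes "r ^ 4 = 2 * r ^ 3 + 2 * r\<^sup>2 + 2 * r - 1"
  shows "r ^ (n + 4) = 2 * r ^ (n + 3) + 2 * r ^ (n + 2) + 2 * r ^ (n + 1) - r ^ n"
  unfolding power_add assms by (simp add: algebra_simps)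

lemma golden_formula_recurrence:
  assumes s: "s ^ 4 = s\<^sup>2 + 1"
  shows "golden_formula s (n + 4) = 2 * golden_formula s (n + 3) + 2 * golden_formula s (n + 2)
           + 2 * golden_formula s (n + 1) - golden_formula s n + 2"
proof -
  have i: "\<i>\<^sup>2 = -1" by simp
  have q: "r ^ 4 = 2 * r ^ 3 + 2 * r\<^sup>2 + 2 * r - 1"
    if "r \<in> {s\<^sup>2 + s, s\<^sup>2 - s, 1 - s\<^sup>2 + \<i> * (s ^ 3 - s), 1 - s\<^sup>2 - \<i> * (s ^ 3 - s)}" for r
    using that s i by (elim insertE emptyE) (simp only:, algebra)+
  \<comment> \<open>The summand \<open>2\<close> comes from the constant: \<open>- 1 / 2 = (2 + 2 + 2 - 1) * (- 1 / 2) + 2\<close>.\<close>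
  have lin: "(a * (2*x3+2*x2+2*x1-x0) + b * (2*y3+2*y2+2*y1-y0) - c * (2*z3+2*z2+2*z1-z0)
     - d * (2*w3+2*w2+2*w1-w0)) / N - 1/2
    = 2 * ((a*x3+b*y3-c*z3-d*w3)/N - 1/2) + 2 * ((a*x2+b*y2-c*z2-d*w2)/N - 1/2)
      + 2 * ((a*x1+b*y1-c*z1-d*w1)/N - 1/2) - ((a*x0+b*y0-c*z0-d*w0)/N - 1/2) + 2"
    for a b c d x0 x1 x2 x3 y0 y1 y2 y3 z0 z1 z2 z3 w0 w1 w2 w3 N :: complex
    by (simp add: algebra_simps diff_divide_distrib add_divide_distrib)
  show ?thesis
    unfolding golden_formula_def power_recurrence[OF q[OF insertI1]]
      power_recurrence[OF q[OF insertI2[OF insertI1]]]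
      power_recurrence[OF q[OF insertI2[OF insertI2[OF insertI1]]]]
      power_recurrence[OF q[OF insertI2[OF insertI2[OF insertI2[OF insertI1]]]]]
    by (rule lin)
qed

text \<open>
  Running the recurrence backwards from the tree counts \<open>1\<close>, \<open>4\<close>, \<open>12\<close>, \<open>36\<close>, which start at
  \<open>n = 3\<close>, leads to the values \<open>0\<close> at \<open>n = 2, 1, 0\<close>. These are not tree counts, but the
  formula is easier to evaluate there than at \<open>n = 4, 5, 6\<close>.
\<close>

lemma golden_formula_initial:
  assumes s: "s ^ 4 = s\<^sup>2 + 1"
  shows "golden_formula s 0 = 0" "golden_formula s 1 = 0" "golden_formula s 2 = 0"
    "golden_formula s 3 = 1"
proof -
  have i: "\<i>\<^sup>2 = -1" by simp
  have nz: "2 * s\<^sup>2 - 1 \<noteq> 0"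
  proof
    assume "2 * s\<^sup>2 - 1 = 0"
    with s have "(5 :: complex) = 0" by algebra
    then show False by simp
  qed
  have eq: "x / (4 * (2 * s\<^sup>2 - 1)) - 1 / 2 = y \<longleftrightarrow> x = (2 * s\<^sup>2 - 1) * (4 * y + 2)" for x y
  proof -
    have "x / (4 * (2 * s\<^sup>2 - 1)) - 1 / 2 = y \<longleftrightarrow> x / (4 * (2 * s\<^sup>2 - 1)) = y + 1 / 2"
      by (auto simp: algebra_simps)
    also have "\<dots> \<longleftrightarrow> x = (y + 1 / 2) * (4 * (2 * s\<^sup>2 - 1))"
      using nz by (intro nonzero_divide_eq_eq) simp
    also have "(y + 1 / 2) * (4 * (2 * s\<^sup>2 - 1)) = (2 * s\<^sup>2 - 1) * (4 * y + 2)"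
      by (simp add: algebra_simps)
    finally show ?thesis .
  qed
  show "golden_formula s 0 = 0" unfolding golden_formula_def eq using s i by algebra
  show "golden_formula s 1 = 0" unfolding golden_formula_def eq using s i by algebra
  show "golden_formula s 2 = 0" unfolding golden_formula_def eq using s i by algebra
  show "golden_formula s 3 = 1" unfolding golden_formula_def eq using s i by algebra
qed

lemma sqrt_golden_power4:
  assumes "\<gamma> = (sqrt 5 + 1) / 2"
  shows "sqrt \<gamma> ^ 4 = (sqrt \<gamma>)\<^sup>2 + 1"
proof -
  have "\<gamma> \<ge> 0" and "\<gamma>\<^sup>2 = \<gamma> + 1"
    unfolding assms by (simp_all add: power2_eq_square field_simps)
  then show ?thesis
    using power_mult[of "sqrt \<gamma>" 2 2] by simp
qed

lemma golden_formula_sqrt: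
  assumes \<gamma>: "\<gamma> = (sqrt 5 + 1) / 2"
  shows "golden_formula (complex_of_real (sqrt \<gamma>)) n =
      complex_of_real ((\<gamma>\<^sup>2 - \<gamma> powr (3/2)) / (4 * sqrt 5)) * complex_of_real (\<gamma> + sqrt \<gamma>) ^ n
    - 1 / 2
    + complex_of_real ((\<gamma>\<^sup>2 + \<gamma> powr (3/2)) / (4 * sqrt 5)) * complex_of_real (\<gamma> - sqrt \<gamma>) ^ n
    + (- complex_of_real (\<gamma> powr (-2)) - \<i> * complex_of_real (\<gamma> powr (-3/2)))
        / complex_of_real (4 * sqrt 5)
        * (- complex_of_real (\<gamma> powr (-1)) + \<i> / complex_of_real (sqrt \<gamma>)) ^ n
    + (- complex_of_real (\<gamma> powr (-2)) + \<i> * complex_of_real (\<gamma> powr (-3/2)))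
        / complex_of_real (4 * sqrt 5)
        * (- complex_of_real (\<gamma> powr (-1)) - \<i> / complex_of_real (sqrt \<gamma>)) ^ n"
proof -
  define s where "s = sqrt \<gamma>"
  have "\<gamma> > 0" unfolding \<gamma> by (simp add: add_nonneg_pos)
  then have pos: "\<gamma> > 0" "s > 0" by (auto simp: s_def)
  have g2: "\<gamma>\<^sup>2 = \<gamma> + 1" unfolding \<gamma> by (simp add: power2_eq_square field_simps)
  have s2: "s\<^sup>2 = \<gamma>" using pos by (simp add: s_def)
  have s4: "s ^ 4 = s\<^sup>2 + 1" unfolding s_def by (rule sqrt_golden_power4[OF \<gamma>])
  have s3: "s ^ 3 = \<gamma> * s" using s2 by (simp add: power3_eq_cube power2_eq_square)
  have sp: "\<gamma> powr (1/2) = s" using pos by (simp add: s_def powr_half_sqrt)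
  have inv: "inverse \<gamma> = \<gamma> - 1" using g2 pos by (simp add: field_simps power2_eq_square)
  have p1: "\<gamma> powr (3/2) = s ^ 3"
    using powr_add[of \<gamma> 1 "1/2"] sp pos s3 by simp
  have m1: "\<gamma> powr (-1) = s\<^sup>2 - 1"
    using pos inv s2 by (simp add: powr_minus)
  have m2: "\<gamma> powr (-2) = 2 - s\<^sup>2"
  proof -
    have "\<gamma> powr (-2) = (s\<^sup>2 - 1) * (s\<^sup>2 - 1)"
      using powr_add[of \<gamma> "-1" "-1"] unfolding m1 by simp
    also have "\<dots> = 2 - s\<^sup>2" using s4 by algebra
    finally show ?thesis .
  qed
  have m3: "\<gamma> powr (-3/2) = s * (2 - s\<^sup>2)"
    using powr_add[of \<gamma> "-2" "1/2"] sp m2 by simp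
  have inv_s: "1 / s = s ^ 3 - s"
    using s4 pos by (simp add: field_simps eval_nat_numeral)
  have r5: "sqrt 5 = 2 * s\<^sup>2 - 1" using s2 \<gamma> by simp
  let ?s = "complex_of_real s"
  have e: "\<i> / ?s = \<i> * (?s ^ 3 - ?s)"
  proof -
    have "complex_of_real (1 / s) = ?s ^ 3 - ?s" by (simp add: inv_s)
    then show ?thesis by (simp add: divide_inverse)
  qed
  have g: "\<gamma>\<^sup>2 = s ^ 4" "\<gamma> + s = s\<^sup>2 + s" "\<gamma> - s = s\<^sup>2 - s"
    using s4 g2 s2 by auto
  have q: "((a::complex) * x + b * y - c * z - d * w) / N - 1 / 2
     = a / N * x - 1 / 2 + b / N * y + (- c) / N * z + (- d) / N * w" for a b c d x y z w N
    by (simp add: diff_divide_distrib add_divide_distrib)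
  show ?thesis
    unfolding golden_formula_def s_def[symmetric] e g p1 m1 m2 m3 r5 q
    by (simp add: algebra_simps)
qed

theorem proposition1p9:
  fixes n :: nat and \<gamma> :: real
  assumes \<gamma>: "\<gamma> = (sqrt 5 + 1) / 2"
    and n: "n \<ge> 3"
  shows "complex_of_nat (num_spanning_trees (helix3_segment 0 (int n - 1))) =
      complex_of_real ((\<gamma>\<^sup>2 - \<gamma> powr (3/2)) / (4 * sqrt 5)) * complex_of_real (\<gamma> + sqrt \<gamma>) ^ n
    - 1 / 2
    + complex_of_real ((\<gamma>\<^sup>2 + \<gamma> powr (3/2)) / (4 * sqrt 5)) * complex_of_real (\<gamma> - sqrt \<gamma>) ^ n
    + (- complex_of_real (\<gamma> powr (-2)) - \<i> * complex_of_real (\<gamma> powr (-3/2)))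
        / complex_of_real (4 * sqrt 5)
        * (- complex_of_real (\<gamma> powr (-1)) + \<i> / complex_of_real (sqrt \<gamma>)) ^ n
    + (- complex_of_real (\<gamma> powr (-2)) + \<i> * complex_of_real (\<gamma> powr (-3/2)))
        / complex_of_real (4 * sqrt 5)
        * (- complex_of_real (\<gamma> powr (-1)) - \<i> / complex_of_real (sqrt \<gamma>)) ^ n"
proof -
  let ?t = "\<lambda>k. card (states k LMR)"
  define s where "s = complex_of_real (sqrt \<gamma>)"
  have s: "s ^ 4 = s\<^sup>2 + 1"
    unfolding s_def by (metis sqrt_golden_power4[OF \<gamma>] of_real_1 of_real_add of_real_power)
  note rec = golden_formula_recurrence[OF s]
  have t_rec: "complex_of_nat (?t (k + 4)) = 2 * of_nat (?t (k + 3)) + 2 * of_nat (?t (k + 2))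
      + 2 * of_nat (?t (k + 1)) - of_nat (?t k) + 2" for k
    using arg_cong[OF tree_recurrence[of k], of complex_of_nat] by (simp add: algebra_simps)
  have t_init: "?t 0 = 1" "?t 1 = 4" "?t 2 = 12" "?t 3 = 36"
    by (simp_all add: eval_nat_numeral transfer_matrix initial_states)
  have g_init: "golden_formula s 3 = 1" "golden_formula s 4 = 4" "golden_formula s 5 = 12"
    "golden_formula s 6 = 36"
    using rec[of 0] rec[of 1] rec[of 2] golden_formula_initial[OF s] by (simp_all add: numeral_eq_Suc)
  \<comment> \<open>Both sides satisfy the same recurrence of order four, hence four consecutive values.\<close>
  have "of_nat (?t k) = golden_formula s (k + 3) \<and> of_nat (?t (k + 1)) = golden_formula s (k + 4)
      \<and> of_nat (?t (k + 2)) = golden_formula s (k + 5) \<and> of_nat (?t (k + 3)) = golden_formula s (k + 6)"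
    for k
  proof (induction k)
    case 0
    show ?case by (simp only: add_0 t_init g_init of_nat_1 of_nat_numeral simp_thms)
  next
    case (Suc k)
    have shift: "Suc k = k + 1" "k + 1 + 1 = k + 2" "k + 1 + 2 = k + 3" "k + 1 + 3 = k + 4"
      "k + 1 + 4 = k + 5" "k + 1 + 5 = k + 6" "k + 1 + 6 = k + 7" by simp_all
    have "golden_formula s (k + 7) = 2 * golden_formula s (k + 6) + 2 * golden_formula s (k + 5)
        + 2 * golden_formula s (k + 4) - golden_formula s (k + 3) + 2"
      using rec[of "k + 3"] by (simp add: ac_simps)
    then show ?case
      unfolding shift t_rec using Suc.IH by (simp only: simp_thms)
  qed
  then have "of_nat (?t (n - 3)) = golden_formula s n"
    using n by (metis le_add_diff_inverse2)
  moreover have "num_spanning_trees (helix3_segment 0 (int n - 1)) = ?t (n - 3)"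
    using num_spanning_trees_segment[of "n - 3"] n by (simp add: of_nat_diff)
  ultimately show ?thesis
    unfolding s_def golden_formula_sqrt[OF \<gamma>] by simp
qed

end
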